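(* Let $\mathcal E$ be the set of all $(a,b)\in(0,1)\times[0,1)$ such that the rotation number $\rho(a,b)$ is irrational. Then the Hausdorff dimension of $\mathcal E$ (as a subset of $\mathbb R^2$) is $1$.
   Context: For $0<a<1$, $0\le b<1$, consider the multi-valued map $f_\pm$ on $[0,1]$, $x\mapsto\{f_-(x),f_+(x)\}$ with $f_-(x)=\{ax+b\}$ and $f_+(x)=\{ax+b\}_+$, where $\{x\}:=x-\lfloor x\rfloor$ and $\{x\}_+:=1-\{-x\}$. Let $F_-(x):=ax+b+(1-a)\lfloor x\rfloor$ and $F_+(x):=ax+b-(1-a)\lfloor 1-x\rfloor$ for $x\in\mathbb R$. The rotation number $\rho(a,b)\in[0,1)$ of $f_\pm$ is the number such that $F_-^n(x)/n\to\rho(a,b)$ and $F_+^n(x)/n\to\rho(a,b)$ as $n\to\infty$ for every $x\in\mathbb R$ (the limits exist, coincide and do not depend on $x$). *)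

theory Defs
  imports "HOL-Analysis.Analysis"
begin

section \<open>Hausdorff measure and Hausdorff dimension\<close>

text \<open>
  The contribution \<open>(diam U)\<^sup>s\<close> of a covering set, with the usual conventions that the empty
  set contributes nothing and that \<open>0\<^sup>0 = 1\<close> for nonempty \<open>U\<close> (whereas \<open>0 powr 0 = 0\<close> in the
  library), so that the 0-dimensional measure is counting measure.
\<close>
definition hausdorff_gauge :: "real \<Rightarrow> 'a::metric_space set \<Rightarrow> ennreal" where
  "hausdorff_gauge s U =
     (if U = {} then 0 else if s = 0 then 1 else ennreal (diameter U powr s))"

text \<open>
  Boundedness is required explicitly because \<^const>\<open>diameter\<close> is a real supremum and hence
  carries no information for unbounded sets. Finite covers are included, since cover members
  may be empty.
\<close>
definition delta_covers :: "real \<Rightarrow> 'a::metric_space set \<Rightarrow> (nat \<Rightarrow> 'a set) set" where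
  "delta_covers \<delta> A =
     {U. A \<subseteq> (\<Union>i. U i) \<and> (\<forall>i. bounded (U i) \<and> diameter (U i) \<le> \<delta>)}"

definition hausdorff_premeasure :: "real \<Rightarrow> real \<Rightarrow> 'a::metric_space set \<Rightarrow> ennreal" where
  "hausdorff_premeasure s \<delta> A = (INF U \<in> delta_covers \<delta> A. \<Sum>i. hausdorff_gauge s (U i))"

definition hausdorff_measure :: "real \<Rightarrow> 'a::metric_space set \<Rightarrow> ennreal" where
  "hausdorff_measure s A = (SUP \<delta> \<in> {0<..}. hausdorff_premeasure s \<delta> A)"

definition hausdorff_dim :: "'a::metric_space set \<Rightarrow> ennreal" where
  "hausdorff_dim A = (INF s \<in> {s. 0 \<le> s \<and> hausdorff_measure s A = 0}. ennreal s)"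

section \<open>The lifts and the rotation number\<close>

definition F_minus :: "real \<Rightarrow> real \<Rightarrow> real \<Rightarrow> real" where
  "F_minus a b x = a * x + b + (1 - a) * of_int \<lfloor>x\<rfloor>"

definition F_plus :: "real \<Rightarrow> real \<Rightarrow> real \<Rightarrow> real" where
  "F_plus a b x = a * x + b - (1 - a) * of_int \<lfloor>1 - x\<rfloor>"

text \<open>
  These are lifts, commuting with \<open>x \<mapsto> x + 1\<close>, of the two branches
  \<open>f\<^sub>-(x) = {ax + b}\<close> and \<open>f\<^sub>+(x) = {ax + b}\<^sub>+\<close> of the contracted rotation: both equal
  \<open>ax + b\<close> on \<open>(0,1)\<close>; \<^const>\<open>F_minus\<close> is right-continuous and \<^const>\<open>F_plus\<close> left-continuous
  at the integers.
\<close>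
definition rotation_number :: "real \<Rightarrow> real \<Rightarrow> real" where
  "rotation_number a b = (THE \<rho>. \<rho> \<in> {0..<1} \<and>
     (\<forall>x. (\<lambda>n. (F_minus a b ^^ n) x / real n) \<longlonglongrightarrow> \<rho>) \<and>
     (\<forall>x. (\<lambda>n. (F_plus a b ^^ n) x / real n) \<longlonglongrightarrow> \<rho>))"

end

theory Submission
  imports Defs
begin

text \<open>
  For fixed \<open>a\<close> the rotation number is a nondecreasing function of \<open>b\<close> with monotone right
  inverse \<open>crit a \<rho> = (1 - a) * (\<Sum>k. a ^ k * (\<lceil>(k + 1) * \<rho>\<rceil> - \<lceil>k * \<rho>\<rceil>))\<close>, the parameter at which a
  monotone \<open>h\<close> fixing the integers semiconjugates the translation by \<open>\<rho>\<close> to the lifts. Since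
  \<open>crit a\<close> is continuous at irrational points, every pair with irrational rotation number has the
  form \<open>(a, crit a \<rho>)\<close>.

  The coefficients of the series lie in \<open>{0, 1}\<close>, so for \<open>a \<le> a0\<close> the values \<open>\<lceil>k * \<rho>\<rceil>\<close> with
  \<open>k \<le> K\<close> determine \<open>crit a \<rho>\<close> up to \<open>a0 ^ K\<close>, and only \<open>O(K\<^sup>2)\<close> such vectors occur. Cutting
  the \<open>a\<close>-axis into pieces of length \<open>a0 ^ K\<close> covers the set by \<open>O(K\<^sup>2 / a0 ^ K)\<close> sets of diameter
  \<open>O(a0 ^ K)\<close>, whence dimension at most 1. Conversely each \<open>a\<close> occurs with each irrational
  \<open>\<rho>\<close>, so the set projects onto an interval and has dimension at least 1.
\<close>

section \<open>The semiconjugacy and the critical parameter\<close>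

text \<open>
  The differences of floors, instead of \<open>\<lfloor>y - (k + 1) * \<rho>\<rfloor>\<close> alone, keep the coefficients bounded
  and normalise the map to fix 0.
\<close>

definition conj_map :: "real \<Rightarrow> real \<Rightarrow> real \<Rightarrow> real" where
  "conj_map a \<rho> y =
     (1 - a) * (\<Sum>k. a ^ k * of_int (\<lfloor>y - real (Suc k) * \<rho>\<rfloor> - \<lfloor>- (real (Suc k) * \<rho>)\<rfloor>))"

definition crit :: "real \<Rightarrow> real \<Rightarrow> real" where
  "crit a \<rho> = (1 - a) * (\<Sum>k. a ^ k * of_int (\<lceil>real (Suc k) * \<rho>\<rceil> - \<lceil>real k * \<rho>\<rceil>))"

section \<open>Power series with bounded coefficients\<close>

lemma summable_power_bounded:
  fixes a :: real
  assumes "0 < a" "a < 1" "\<And>k. \<bar>e k\<bar> \<le> C"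
  shows "summable (\<lambda>k. a ^ k * e k)"
proof (rule summable_comparison_test')
  show "summable (\<lambda>k. C * a ^ k)"
    using assms by (intro summable_mult summable_geometric) auto
  show "norm (a ^ k * e k) \<le> C * a ^ k" if "k \<ge> 0" for k
    using assms(1) assms(3)[of k] by (simp add: abs_mult mult.commute)
qed

text \<open>Once the first \<open>K\<close> coefficients vanish, the geometric tail
  \<open>a ^ K / (1 - a)\<close> dominates; the factor \<open>1 - a\<close> is the one carried by
  \<open>crit\<close>.\<close>

lemma abs_suminf_power_le:
  fixes a :: real
  assumes "0 < a" "a < 1" "\<And>k. \<bar>e k\<bar> \<le> 1" "\<And>k. k < K \<Longrightarrow> e k = 0"
  shows "(1 - a) * \<bar>\<Sum>k. a ^ k * e k\<bar> \<le> a ^ K"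
proof -
  have s: "summable (\<lambda>k. a ^ k * e k)"
    using summable_power_bounded[OF assms(1,2,3)] .
  have g: "(\<lambda>k. a ^ (k + K)) sums (a ^ K / (1 - a))"
    using sums_mult2[OF geometric_sums[of a], of "a ^ K"] assms(1,2) by (simp add: power_add)
  have "(\<Sum>k. a ^ k * e k) = (\<Sum>k. a ^ (k + K) * e (k + K))"
    using suminf_split_initial_segment[OF s, of K] assms(4) by simp
  also have "\<bar>\<dots>\<bar> \<le> (\<Sum>k. a ^ (k + K))"
    unfolding real_norm_def[symmetric]
  proof (rule norm_suminf_le)
    show "norm (a ^ (k + K) * e (k + K)) \<le> a ^ (k + K)" for k
      using assms(1) assms(3)[of "k + K"] by (simp add: abs_mult mult_left_le)
  qed (use g sums_summable in blast)
  also have "\<dots> = a ^ K / (1 - a)"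
    using g sums_unique by metis
  finally show ?thesis
    using assms(2) by (simp add: pos_le_divide_eq mult.commute)
qed

lemma floor_diff_bounded:
  fixes y t :: real
  shows "\<bar>of_int (\<lfloor>y - t\<rfloor> - \<lfloor>- t\<rfloor>) :: real\<bar> \<le> \<bar>y\<bar> + 1"
  using floor_correct[of "y - t"] floor_correct[of "-t"] unfolding of_int_diff by linarith

lemma summable_conj_map:
  fixes a :: real
  assumes "0 < a" "a < 1"
  shows "summable (\<lambda>k. a ^ k * of_int (\<lfloor>y - real (Suc k) * \<rho>\<rfloor> - \<lfloor>- (real (Suc k) * \<rho>)\<rfloor>))"
  by (rule summable_power_bounded[OF assms, where C = "\<bar>y\<bar> + 1"]) (rule floor_diff_bounded)

text \<open>\<open>F_minus a b\<close> sends 0 to \<open>b\<close> and \<open>conj_map\<close> fixes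
  0, so a semiconjugacy with the translation by \<open>\<rho>\<close> forces \<open>b\<close> to be
  the value of \<open>conj_map\<close> at \<open>\<rho>\<close>.\<close>

lemma crit_eq_conj_map: "crit a \<rho> = conj_map a \<rho> \<rho>"
proof -
  have "\<lceil>real (Suc k) * \<rho>\<rceil> - \<lceil>real k * \<rho>\<rceil> = \<lfloor>\<rho> - real (Suc k) * \<rho>\<rfloor> - \<lfloor>- (real (Suc k) * \<rho>)\<rfloor>" for k
  proof -
    have "\<rho> - real (Suc k) * \<rho> = - (real k * \<rho>)" by (simp add: algebra_simps)
    then show ?thesis by (simp add: ceiling_def)
  qed
  then show ?thesis unfolding crit_def conj_map_def by simp
qed

lemma summable_crit:
  fixes a :: real
  assumes "0 < a" "a < 1"
  shows "summable (\<lambda>k. a ^ k * of_int (\<lceil>real (Suc k) * \<rho>\<rceil> - \<lceil>real k * \<rho>\<rceil>))"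
proof (rule summable_power_bounded[OF assms, where C = "\<bar>\<rho>\<bar> + 1"])
  show "\<bar>of_int (\<lceil>real (Suc k) * \<rho>\<rceil> - \<lceil>real k * \<rho>\<rceil>) :: real\<bar> \<le> \<bar>\<rho>\<bar> + 1" for k
  proof -
    have "real (Suc k) * \<rho> = real k * \<rho> + \<rho>" by (simp add: algebra_simps)
    then show ?thesis
      using ceiling_correct[of "real (Suc k) * \<rho>"] ceiling_correct[of "real k * \<rho>"]
      unfolding of_int_diff by linarith
  qed
qed

lemma conj_map_mono:
  assumes "0 < a" "a < 1" "y \<le> z"
  shows "conj_map a \<rho> y \<le> conj_map a \<rho> z"
  unfolding conj_map_def
  using assms
  by (intro mult_left_mono suminf_le summable_conj_map) (auto intro!: floor_mono)

lemma conj_map_of_int [simp]: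
  assumes "0 < a" "a < 1"
  shows "conj_map a \<rho> (of_int n) = of_int n"
proof -
  have "\<lfloor>of_int n - t\<rfloor> - \<lfloor>- t\<rfloor> = n" for t :: real
    by linarith
  then have "conj_map a \<rho> (of_int n) = (1 - a) * (\<Sum>k. a ^ k * of_int n)"
    unfolding conj_map_def by presburger
  also have "\<dots> = of_int n"
    using assms by (simp add: suminf_mult2[symmetric] suminf_geometric summable_geometric)
  finally show ?thesis .
qed

text \<open>Monotonicity between two fixed integers. These bounds relate
  \<open>\<lfloor>y\<rfloor>\<close>, which occurs in the functional equation, to the floor or
  ceiling of \<open>conj_map a \<rho> y\<close>, which occurs in the lifts.\<close>

lemma conj_map_bounds:
  assumes "0 < a" "a < 1"
  shows "of_int \<lfloor>y\<rfloor> \<le> conj_map a \<rho> y" "conj_map a \<rho> y \<le> of_int \<lfloor>y\<rfloor> + 1"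
proof -
  have "conj_map a \<rho> (of_int \<lfloor>y\<rfloor>) \<le> conj_map a \<rho> y"
    by (rule conj_map_mono[OF assms]) simp
  then show "of_int \<lfloor>y\<rfloor> \<le> conj_map a \<rho> y" using assms by simp
  have "conj_map a \<rho> y \<le> conj_map a \<rho> (of_int (\<lfloor>y\<rfloor> + 1))"
    by (rule conj_map_mono[OF assms]) linarith
  then show "conj_map a \<rho> y \<le> of_int \<lfloor>y\<rfloor> + 1"
    unfolding conj_map_of_int[OF assms] by simp
qed

text \<open>Adding \<open>\<rho>\<close> to \<open>y\<close> shifts the index of the floors by one.
  The right-hand side is \<open>F_minus\<close> at \<open>conj_map a \<rho> y\<close>, except that
  the floor is that of \<open>y\<close>.\<close>

lemma conj_map_add:
  assumes "0 < a" "a < 1"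
  shows "conj_map a \<rho> (y + \<rho>) = a * conj_map a \<rho> y + crit a \<rho> + (1 - a) * of_int \<lfloor>y\<rfloor>"
proof -
  \<comment> \<open>\<open>u (Suc k)\<close> is the coefficient of
    \<open>conj_map a \<rho> y\<close> and \<open>u 0\<close> is \<open>\<lfloor>y\<rfloor>\<close>;
    the shift of the normalising floors contributes exactly the series of
    \<open>crit\<close>.\<close>
  define u where "u = (\<lambda>k. of_int (\<lfloor>y - real k * \<rho>\<rfloor> - \<lfloor>- (real k * \<rho>)\<rfloor>) :: real)"
  have su: "summable (\<lambda>k. a ^ k * u k)"
    unfolding u_def
    by (rule summable_power_bounded[OF assms, where C = "\<bar>y\<bar> + 1"]) (rule floor_diff_bounded)
  have su': "summable (\<lambda>k. a ^ k * u (Suc k))"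
    unfolding u_def by (rule summable_conj_map[OF assms])
  have term_eq: "a ^ k * of_int (\<lfloor>y + \<rho> - real (Suc k) * \<rho>\<rfloor> - \<lfloor>- (real (Suc k) * \<rho>)\<rfloor>) =
      a ^ k * u k + a ^ k * of_int (\<lceil>real (Suc k) * \<rho>\<rceil> - \<lceil>real k * \<rho>\<rceil>)" for k
  proof -
    have "y + \<rho> - real (Suc k) * \<rho> = y - real k * \<rho>" by (simp add: algebra_simps)
    then show ?thesis by (simp add: u_def ceiling_def algebra_simps)
  qed
  have "conj_map a \<rho> (y + \<rho>) = (1 - a) * (\<Sum>k. a ^ k * u k) + crit a \<rho>"
    unfolding conj_map_def crit_def term_eq
    unfolding suminf_add[OF su summable_crit[OF assms, of \<rho>], symmetric] by (rule distrib_left)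
  also have "(\<Sum>k. a ^ k * u k) = u 0 + (\<Sum>k. a ^ Suc k * u (Suc k))"
    using suminf_split_head[OF su] by simp
  also have "(\<Sum>k. a ^ Suc k * u (Suc k)) = a * (\<Sum>k. a ^ k * u (Suc k))"
    using suminf_mult[OF su', of a] by (simp add: mult.assoc)
  also have "(1 - a) * (u 0 + a * (\<Sum>k. a ^ k * u (Suc k))) =
      (1 - a) * of_int \<lfloor>y\<rfloor> + a * conj_map a \<rho> y"
    unfolding conj_map_def u_def by (simp add: algebra_simps)
  finally show ?thesis by simp
qed

section \<open>Rotation numbers\<close>

lemma F_minus_mono: "F_minus a b x \<le> F_minus a b y" if "0 < a" "a < 1" "x \<le> y"
  unfolding F_minus_def using that
  by (intro add_mono mult_left_mono) (auto intro: floor_mono)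

lemma F_plus_mono: "F_plus a b x \<le> F_plus a b y" if "0 < a" "a < 1" "x \<le> y"
  unfolding F_plus_def using that
  by (intro diff_mono add_mono mult_left_mono) (auto intro: floor_mono)

text \<open>\<open>- \<lfloor>1 - y\<rfloor>\<close> is the ceiling of \<open>y\<close> minus 1,
  which is at least \<open>\<lfloor>x\<rfloor>\<close> when \<open>x < y\<close>. So lower bounds
  for \<open>F_minus\<close> and upper bounds for \<open>F_plus\<close> carry over to the other lift
  after a small shift of the starting point.\<close>

lemma F_minus_less_F_plus: "F_minus a b x < F_plus a b y" if "0 < a" "a < 1" "x < y"
proof -
  have "\<lfloor>x\<rfloor> \<le> - \<lfloor>1 - y\<rfloor>" using that by linarith
  then have "(1 - a) * of_int \<lfloor>x\<rfloor> \<le> (1 - a) * of_int (- \<lfloor>1 - y\<rfloor>)"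
    using that by (intro mult_left_mono) auto
  moreover have "a * x < a * y" using that by simp
  ultimately show ?thesis unfolding F_minus_def F_plus_def by simp
qed

lemma F_minus_iter_less_F_plus_iter:
  assumes "0 < a" "a < 1" "x < y"
  shows "(F_minus a b ^^ n) x < (F_plus a b ^^ n) y"
  using assms by (induction n) (auto intro: F_minus_less_F_plus)

lemma F_minus_iter_mono:
  assumes "0 < a" "a < 1" "x \<le> y"
  shows "(F_minus a b ^^ n) x \<le> (F_minus a b ^^ n) y"
  using assms by (induction n) (auto intro: F_minus_mono)

lemma F_plus_iter_mono:
  assumes "0 < a" "a < 1" "x \<le> y"
  shows "(F_plus a b ^^ n) x \<le> (F_plus a b ^^ n) y"
  using assms by (induction n) (auto intro: F_plus_mono)

text \<open>Induction on the functional equation: passing from the floor of \<open>y\<close> to that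
  of \<open>conj_map a r y\<close> can only increase the right-hand side, and so can passing from
  \<open>crit a r\<close> to \<open>b\<close>.\<close>

lemma conj_map_le_F_minus_iter:
  assumes a: "0 < a" "a < 1" and b: "crit a r \<le> b"
  shows "conj_map a r (y + real n * r) \<le> (F_minus a b ^^ n) (conj_map a r y)"
proof (induction n)
  case (Suc n)
  let ?z = "y + real n * r"
  have "\<lfloor>?z\<rfloor> \<le> \<lfloor>conj_map a r ?z\<rfloor>"
    using conj_map_bounds(1)[OF a] by (simp add: le_floor_iff)
  then have "(1 - a) * of_int \<lfloor>?z\<rfloor> \<le> (1 - a) * of_int \<lfloor>conj_map a r ?z\<rfloor>"
    using a by (intro mult_left_mono) auto
  then have "conj_map a r (?z + r) \<le> F_minus a b (conj_map a r ?z)"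
    unfolding conj_map_add[OF a] F_minus_def using b by linarith
  also have "\<dots> \<le> F_minus a b ((F_minus a b ^^ n) (conj_map a r y))"
    by (rule F_minus_mono[OF a Suc])
  finally show ?case by (simp add: algebra_simps)
qed simp

text \<open>Mirror image: as \<open>conj_map a r z\<close> is at most
  \<open>\<lfloor>z\<rfloor> + 1\<close>, its ceiling minus 1, the step function inside
  \<open>F_plus\<close>, is at most \<open>\<lfloor>z\<rfloor>\<close>.\<close>

lemma F_plus_iter_le_conj_map:
  assumes a: "0 < a" "a < 1" and b: "b \<le> crit a r"
  shows "(F_plus a b ^^ n) (conj_map a r y) \<le> conj_map a r (y + real n * r)"
proof (induction n)
  case (Suc n)
  let ?z = "y + real n * r"
  have "F_plus a b ((F_plus a b ^^ n) (conj_map a r y)) \<le> F_plus a b (conj_map a r ?z)"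
    by (rule F_plus_mono[OF a Suc])
  also have "\<dots> \<le> conj_map a r (?z + r)"
  proof -
    have "- \<lfloor>1 - conj_map a r ?z\<rfloor> \<le> \<lfloor>?z\<rfloor>"
      using conj_map_bounds(2)[OF a, of r ?z] by linarith
    then have "(1 - a) * of_int (- \<lfloor>1 - conj_map a r ?z\<rfloor>) \<le> (1 - a) * of_int \<lfloor>?z\<rfloor>"
      using a by (intro mult_left_mono) auto
    then show ?thesis
      unfolding conj_map_add[OF a] F_plus_def using b by simp
  qed
  finally show ?case by (simp add: algebra_simps)
qed simp

text \<open>Integers are fixed by \<open>conj_map\<close>, so orbits starting there are compared
  with the translation up to 1; rounding \<open>x\<close> to an integer costs a further constant.
  What matters is that the error is independent of \<open>n\<close> and \<open>r\<close>.\<close>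

lemma F_iter_ge:
  assumes a: "0 < a" "a < 1" and b: "crit a r \<le> b"
  shows "(F_minus a b ^^ n) x \<ge> x + real n * r - 3" "(F_plus a b ^^ n) x \<ge> x + real n * r - 3"
proof -
  have m: "(F_minus a b ^^ n) (of_int m) \<ge> of_int m + real n * r - 1" for m :: int
  proof -
    have "of_int m + real n * r - 1 \<le> of_int \<lfloor>of_int m + real n * r\<rfloor>" by linarith
    also have "\<dots> \<le> conj_map a r (of_int m + real n * r)" by (rule conj_map_bounds(1)[OF a])
    also have "\<dots> \<le> (F_minus a b ^^ n) (of_int m)"
      using conj_map_le_F_minus_iter[OF a b, of "of_int m" n] a by simp
    finally show ?thesis .
  qed
  have "(F_minus a b ^^ n) (of_int \<lfloor>x\<rfloor>) \<le> (F_minus a b ^^ n) x"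
    by (rule F_minus_iter_mono[OF a]) simp
  with m[of "\<lfloor>x\<rfloor>"] show "(F_minus a b ^^ n) x \<ge> x + real n * r - 3" by linarith
  \<comment> \<open>The comparison of the two lifts needs a strictly smaller starting point;
    \<open>\<lceil>x\<rceil> - 1\<close> is the largest integer strictly below
    \<open>x\<close>.\<close>
  have "(F_minus a b ^^ n) (of_int (\<lceil>x\<rceil> - 1)) < (F_plus a b ^^ n) x"
    by (rule F_minus_iter_less_F_plus_iter[OF a]) linarith
  with m[of "\<lceil>x\<rceil> - 1"] show "(F_plus a b ^^ n) x \<ge> x + real n * r - 3" by linarith
qed

lemma F_iter_le:
  assumes a: "0 < a" "a < 1" and b: "b \<le> crit a r"
  shows "(F_minus a b ^^ n) x \<le> x + real n * r + 3" "(F_plus a b ^^ n) x \<le> x + real n * r + 3"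
proof -
  have m: "(F_plus a b ^^ n) (of_int m) \<le> of_int m + real n * r + 1" for m :: int
  proof -
    have "(F_plus a b ^^ n) (of_int m) \<le> conj_map a r (of_int m + real n * r)"
      using F_plus_iter_le_conj_map[OF a b, of n "of_int m"] a by simp
    also have "\<dots> \<le> of_int \<lfloor>of_int m + real n * r\<rfloor> + 1" by (rule conj_map_bounds(2)[OF a])
    also have "\<dots> \<le> of_int m + real n * r + 1" by linarith
    finally show ?thesis .
  qed
  have lt: "x < of_int (\<lfloor>x\<rfloor> + 1)" by linarith
  show "(F_minus a b ^^ n) x \<le> x + real n * r + 3"
    using F_minus_iter_less_F_plus_iter[OF a lt, of n b] m[of "\<lfloor>x\<rfloor> + 1"] by linarith
  show "(F_plus a b ^^ n) x \<le> x + real n * r + 3"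
    using F_plus_iter_mono[OF a less_imp_le[OF lt], of n b] m[of "\<lfloor>x\<rfloor> + 1"] by linarith
qed

section \<open>Passage to the limit\<close>

lemma tendsto_div_of_nat_if_bounded_error:
  fixes f :: "nat \<Rightarrow> real"
  assumes "\<And>n. \<bar>f n - real n * \<rho>\<bar> \<le> C"
  shows "(\<lambda>n. f n / real n) \<longlonglongrightarrow> \<rho>"
proof (rule LIM_zero_cancel, rule Lim_null_comparison)
  show "(\<lambda>n. C / real n) \<longlonglongrightarrow> 0" by (rule lim_const_over_n)
  show "\<forall>\<^sub>F n in sequentially. norm (f n / real n - \<rho>) \<le> C / real n"
    using eventually_gt_at_top[of 0]
  proof eventually_elim
    case (elim n)
    have "f n / real n - \<rho> = (f n - real n * \<rho>) / real n"
      using elim by (simp add: field_simps)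
    then show ?case
      using assms[of n] elim by (simp add: divide_right_mono)
  qed
qed

text \<open>Since \<open>crit a\<close> may jump at \<open>\<rho>\<close>, the orbit bounds are
  available only for \<open>r\<close> on one side of \<open>\<rho>\<close>; this and its mirror
  image extend them to \<open>\<rho>\<close>.\<close>

lemma mult_le_if_left_approx:
  fixes c d \<rho> :: real
  assumes "\<And>r. r < \<rho> \<Longrightarrow> c * r \<le> d"
  shows "c * \<rho> \<le> d"
proof (rule tendsto_upperbound)
  show "((\<lambda>r. c * r) \<longlongrightarrow> c * \<rho>) (at_left \<rho>)" by (intro tendsto_intros)
  show "\<forall>\<^sub>F r in at_left \<rho>. c * r \<le> d"
    using assms by (auto simp: eventually_at_filter)
qed simp

lemma mult_ge_if_right_approx:
  fixes c d \<rho> :: real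
  assumes "\<And>r. \<rho> < r \<Longrightarrow> d \<le> c * r"
  shows "d \<le> c * \<rho>"
proof (rule tendsto_lowerbound)
  show "((\<lambda>r. c * r) \<longlongrightarrow> c * \<rho>) (at_right \<rho>)" by (intro tendsto_intros)
  show "\<forall>\<^sub>F r in at_right \<rho>. d \<le> c * r"
    using assms by (auto simp: eventually_at_filter)
qed simp

text \<open>The hypotheses place \<open>b\<close> in the possibly degenerate gap of
  \<open>crit a\<close> at \<open>\<rho>\<close>. For fixed \<open>n\<close>, letting
  \<open>r\<close> tend to \<open>\<rho>\<close> keeps the error 3.\<close>

lemma F_iter_limits:
  assumes a: "0 < a" "a < 1"
    and lo: "\<And>r. r < \<rho> \<Longrightarrow> crit a r \<le> b" and up: "\<And>r. \<rho> < r \<Longrightarrow> b \<le> crit a r"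
  shows "(\<lambda>n. (F_minus a b ^^ n) x / real n) \<longlonglongrightarrow> \<rho>"
    and "(\<lambda>n. (F_plus a b ^^ n) x / real n) \<longlonglongrightarrow> \<rho>"
proof -
  have m1: "real n * \<rho> \<le> (F_minus a b ^^ n) x - x + 3" for n
    by (rule mult_le_if_left_approx) (use F_iter_ge(1)[OF a lo, of _ x n] in \<open>auto simp: algebra_simps\<close>)
  have m2: "(F_minus a b ^^ n) x - x - 3 \<le> real n * \<rho>" for n
    by (rule mult_ge_if_right_approx) (use F_iter_le(1)[OF a up, of _ n x] in \<open>auto simp: algebra_simps\<close>)
  have p1: "real n * \<rho> \<le> (F_plus a b ^^ n) x - x + 3" for n
    by (rule mult_le_if_left_approx) (use F_iter_ge(2)[OF a lo, of _ x n] in \<open>auto simp: algebra_simps\<close>)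
  have p2: "(F_plus a b ^^ n) x - x - 3 \<le> real n * \<rho>" for n
    by (rule mult_ge_if_right_approx) (use F_iter_le(2)[OF a up, of _ n x] in \<open>auto simp: algebra_simps\<close>)
  show "(\<lambda>n. (F_minus a b ^^ n) x / real n) \<longlonglongrightarrow> \<rho>"
    by (rule tendsto_div_of_nat_if_bounded_error[where C = "\<bar>x\<bar> + 3"])
      (use m1 m2 in \<open>smt (verit)\<close>)
  show "(\<lambda>n. (F_plus a b ^^ n) x / real n) \<longlonglongrightarrow> \<rho>"
    by (rule tendsto_div_of_nat_if_bounded_error[where C = "\<bar>x\<bar> + 3"])
      (use p1 p2 in \<open>smt (verit)\<close>)
qed

lemma rotation_number_eqI:
  assumes a: "0 < a" "a < 1" and \<rho>: "0 \<le> \<rho>" "\<rho> < 1"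
    and lo: "\<And>r. r < \<rho> \<Longrightarrow> crit a r \<le> b" and up: "\<And>r. \<rho> < r \<Longrightarrow> b \<le> crit a r"
  shows "rotation_number a b = \<rho>"
  unfolding rotation_number_def
proof (rule the_equality)
  show "\<rho> \<in> {0..<1} \<and> (\<forall>x. (\<lambda>n. (F_minus a b ^^ n) x / real n) \<longlonglongrightarrow> \<rho>) \<and>
      (\<forall>x. (\<lambda>n. (F_plus a b ^^ n) x / real n) \<longlonglongrightarrow> \<rho>)"
    using F_iter_limits[OF a lo up] \<rho> by auto
next
  fix \<sigma>
  assume "\<sigma> \<in> {0..<1} \<and> (\<forall>x. (\<lambda>n. (F_minus a b ^^ n) x / real n) \<longlonglongrightarrow> \<sigma>) \<and>
      (\<forall>x. (\<lambda>n. (F_plus a b ^^ n) x / real n) \<longlonglongrightarrow> \<sigma>)"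
  then have "(\<lambda>n. (F_minus a b ^^ n) 0 / real n) \<longlonglongrightarrow> \<sigma>" by blast
  then show "\<sigma> = \<rho>"
    using F_iter_limits(1)[OF a lo up] by (rule LIMSEQ_unique)
qed

section \<open>The critical parameter as a function of the rotation number\<close>

lemma sum_power_diff_abel:
  fixes a :: real
  assumes "c 0 = 0"
  shows "(\<Sum>k<n. a ^ k * (c (Suc k) - c k)) = a ^ n * c n + (1 - a) * (\<Sum>k<n. a ^ k * c (Suc k))"
  using assms by (induction n) (auto simp: algebra_simps)

text \<open>The series defining \<^const>\<open>crit\<close> is not termwise monotone; summation by parts makes it so.\<close>

lemma crit_mono:
  assumes a: "0 < a" "a < 1" and "r \<le> r'"
  shows "crit a r \<le> crit a r'"
proof -
  have sums: "(\<lambda>n. \<Sum>k<n. a ^ k * of_int (\<lceil>real (Suc k) * r\<rceil> - \<lceil>real k * r\<rceil>))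
      \<longlonglongrightarrow> (\<Sum>k. a ^ k * of_int (\<lceil>real (Suc k) * r\<rceil> - \<lceil>real k * r\<rceil>))" for r
    using summable_LIMSEQ[OF summable_crit[OF a]] .
  have c: "of_int \<lceil>real k * r\<rceil> \<le> (of_int \<lceil>real k * r'\<rceil> :: real)" for k
    using \<open>r \<le> r'\<close> by (simp add: ceiling_mono mult_left_mono)
  have "(\<Sum>k<n. a ^ k * of_int (\<lceil>real (Suc k) * r\<rceil> - \<lceil>real k * r\<rceil>))
      \<le> (\<Sum>k<n. a ^ k * of_int (\<lceil>real (Suc k) * r'\<rceil> - \<lceil>real k * r'\<rceil>))" for n
  proof -
    have abel: "(\<Sum>k<n. a ^ k * of_int (\<lceil>real (Suc k) * s\<rceil> - \<lceil>real k * s\<rceil>)) =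
        a ^ n * of_int \<lceil>real n * s\<rceil> + (1 - a) * (\<Sum>k<n. a ^ k * of_int \<lceil>real (Suc k) * s\<rceil>)" for s
      unfolding of_int_diff by (rule sum_power_diff_abel) simp
    show ?thesis
      unfolding abel using a by (intro add_mono mult_left_mono sum_mono c) auto
  qed
  then show ?thesis
    unfolding crit_def using a
    by (intro mult_left_mono LIMSEQ_le[OF sums sums]) auto
qed

lemma crit_0 [simp]: "crit a 0 = 0"
  by (simp add: crit_def)

lemma crit_1 [simp]: "0 < a \<Longrightarrow> a < 1 \<Longrightarrow> crit a 1 = 1"
  using conj_map_of_int[of a 1 1] by (simp add: crit_eq_conj_map)

text \<open>\<open>r\<close> is recovered from \<open>crit a r\<close> as the growth rate of the
  orbit of 0.\<close>

lemma crit_inj: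
  assumes a: "0 < a" "a < 1" and eq: "crit a r = crit a r'"
  shows "r = r'"
proof -
  have "(\<lambda>n. (F_minus a (crit a r) ^^ n) 0 / real n) \<longlonglongrightarrow> r" for r
    by (rule F_iter_limits[OF a]) (auto intro: crit_mono[OF a])
  then show ?thesis using LIMSEQ_unique eq by metis
qed

lemma rotation_number_crit:
  assumes "0 < a" "a < 1" "0 \<le> \<rho>" "\<rho> < 1"
  shows "rotation_number a (crit a \<rho>) = \<rho>"
  using assms by (intro rotation_number_eqI) (auto intro: crit_mono)

lemma ceiling_diff_unit:
  assumes "0 \<le> \<rho>" "\<rho> \<le> 1"
  shows "of_int (\<lceil>real (Suc k) * \<rho>\<rceil> - \<lceil>real k * \<rho>\<rceil>) \<in> {0, 1 :: real}"
proof -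
  have "real (Suc k) * \<rho> = real k * \<rho> + \<rho>" by (simp add: algebra_simps)
  then have "\<lceil>real k * \<rho>\<rceil> \<le> \<lceil>real (Suc k) * \<rho>\<rceil>" "\<lceil>real (Suc k) * \<rho>\<rceil> \<le> \<lceil>real k * \<rho>\<rceil> + 1"
    using assms by linarith+
  then have "\<lceil>real (Suc k) * \<rho>\<rceil> - \<lceil>real k * \<rho>\<rceil> = 0 \<or> \<lceil>real (Suc k) * \<rho>\<rceil> - \<lceil>real k * \<rho>\<rceil> = 1"
    by linarith
  then show ?thesis by auto
qed

text \<open>The coefficient at \<open>k\<close> involves the ceilings at \<open>k\<close> and
  \<open>Suc k\<close>, so agreement up to \<open>K\<close> equates those below \<open>K\<close>.
  The others lie in {0, 1}, leaving a geometric tail.\<close>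

lemma crit_diff_le_power:
  assumes a: "0 < a" "a < 1" and r: "0 \<le> r" "r \<le> 1" "0 \<le> r'" "r' \<le> 1"
    and eq: "\<And>k. k \<le> K \<Longrightarrow> \<lceil>real k * r\<rceil> = \<lceil>real k * r'\<rceil>"
  shows "\<bar>crit a r - crit a r'\<bar> \<le> a ^ K"
proof -
  define d where "d = (\<lambda>r k. of_int (\<lceil>real (Suc k) * r\<rceil> - \<lceil>real k * r\<rceil>) :: real)"
  have s: "summable (\<lambda>k. a ^ k * d r k)" for r
    unfolding d_def by (rule summable_crit[OF a])
  have "crit a r - crit a r' = (1 - a) * (\<Sum>k. a ^ k * (d r k - d r' k))"
  proof -
    have "crit a r = (1 - a) * (\<Sum>k. a ^ k * d r k)" for r by (simp add: crit_def d_def)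
    then show ?thesis
      unfolding right_diff_distrib[of "a ^ _"] suminf_diff[OF s s, symmetric]
      by (simp only: right_diff_distrib)
  qed
  moreover have "(1 - a) * \<bar>\<Sum>k. a ^ k * (d r k - d r' k)\<bar> \<le> a ^ K"
  proof (rule abs_suminf_power_le[OF a])
    show "\<bar>d r k - d r' k\<bar> \<le> 1" for k
      using ceiling_diff_unit[OF r(1,2), of k] ceiling_diff_unit[OF r(3,4), of k]
      unfolding d_def by auto
    show "d r k - d r' k = 0" if "k < K" for k
      using eq[of k] eq[of "Suc k"] that unfolding d_def by simp
  qed
  ultimately show ?thesis using a by (simp add: abs_mult)
qed

text \<open>A Dedekind cut: \<open>\<rho>\<close> is the supremum of all \<open>r\<close> with
  \<open>crit a r \<le> b\<close>. The delicate point is \<open>\<rho> < 1\<close>, which rests on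
  left continuity of \<open>crit a\<close> at 1.\<close>

lemma rotation_number_cut:
  assumes a: "0 < a" "a < 1" and b: "0 \<le> b" "b < 1"
  obtains \<rho> where "0 \<le> \<rho>" "\<rho> < 1" "rotation_number a b = \<rho>"
    "\<And>r. r < \<rho> \<Longrightarrow> crit a r \<le> b" "\<And>r. \<rho> < r \<Longrightarrow> b \<le> crit a r"
proof -
  define R where "R = {r. crit a r \<le> b}"
  have lt1: "r < 1" if "r \<in> R" for r
    using crit_mono[OF a, of 1 r] that a b unfolding R_def by (cases "r < 1") auto
  have "0 \<in> R" using b by (simp add: R_def)
  have bdd: "bdd_above R" using lt1 by (intro bdd_aboveI[of _ 1]) (auto intro: less_imp_le)
  define \<rho> where "\<rho> = Sup R"
  have \<rho>0: "0 \<le> \<rho>" unfolding \<rho>_def by (rule cSup_upper[OF \<open>0 \<in> R\<close> bdd])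
  have \<rho>1: "\<rho> \<le> 1" unfolding \<rho>_def using \<open>0 \<in> R\<close> lt1 by (intro cSup_least) (auto intro: less_imp_le)
  have lo: "crit a r \<le> b" if "r < \<rho>" for r
  proof -
    have "\<exists>r'\<in>R. r < r'"
      using that \<open>0 \<in> R\<close> bdd unfolding \<rho>_def by (subst (asm) less_cSup_iff) auto
    then obtain r' where "r' \<in> R" "r < r'" by blast
    then show ?thesis using crit_mono[OF a, of r r'] unfolding R_def by simp
  qed
  have up: "b \<le> crit a r" if "\<rho> < r" for r
    using cSup_upper[OF _ bdd, of r] that unfolding \<rho>_def R_def by fastforce
  have "\<rho> \<noteq> 1"
  proof
    assume "\<rho> = 1"
    have "1 - b \<le> a ^ K" for K
    proof -
      \<comment> \<open>This \<open>r\<close> has the same ceilings as 1 at all indices up to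
        \<open>K\<close>, so \<open>crit a r\<close> is within \<open>a ^ K\<close> of 1; yet
        \<open>r < \<rho>\<close> keeps it below \<open>b\<close>.\<close>
      define r where "r = 1 - 1 / (real K + 1)"
      have r: "0 \<le> r" "r < 1" by (auto simp: r_def)
      have "\<lceil>real k * r\<rceil> = \<lceil>real k * 1\<rceil>" if "k \<le> K" for k
      proof -
        have "real k / (real K + 1) < 1" using that by simp
        then have "real k - 1 < real k * r" unfolding r_def right_diff_distrib by simp
        moreover have "real k * r \<le> real k" using r by (simp add: mult_left_le)
        ultimately show ?thesis by (auto simp: ceiling_eq_iff)
      qed
      then have "\<bar>crit a r - crit a 1\<bar> \<le> a ^ K"
        using r by (intro crit_diff_le_power[OF a]) auto
      then show ?thesis using lo[of r] r \<open>\<rho> = 1\<close> a by simp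
    qed
    moreover have "(\<lambda>K. a ^ K) \<longlonglongrightarrow> 0" using a by (simp add: LIMSEQ_power_zero)
    ultimately have "1 - b \<le> 0" by (intro LIMSEQ_le_const) auto
    then show False using b by simp
  qed
  then have "\<rho> < 1" using \<rho>1 by simp
  then show ?thesis using that[OF \<rho>0 _ rotation_number_eqI[OF a \<rho>0 _ lo up] lo up] by blast
qed

text \<open>For \<open>k > 0\<close> the product \<open>real k * \<rho>\<close> is not an integer,
  and the ceiling is locally constant off the integers.\<close>

lemma eventually_ceiling_mult_eq:
  assumes "\<rho> \<notin> \<rat>"
  shows "\<forall>\<^sub>F r in nhds \<rho>. \<lceil>real k * r\<rceil> = \<lceil>real k * \<rho>\<rceil>"
proof (cases "k = 0")
  case False
  have t: "((\<lambda>r. real k * r) \<longlongrightarrow> real k * \<rho>) (nhds \<rho>)" by (intro tendsto_intros filterlim_ident)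
  have ne: "real k * \<rho> \<noteq> of_int \<lceil>real k * \<rho>\<rceil>"
  proof
    assume "real k * \<rho> = of_int \<lceil>real k * \<rho>\<rceil>"
    then have "\<rho> = of_int \<lceil>real k * \<rho>\<rceil> / real k" using False by (simp add: field_simps)
    also have "\<dots> \<in> \<rat>" by simp
    finally show False using assms by simp
  qed
  have "of_int \<lceil>real k * \<rho>\<rceil> - 1 < real k * \<rho>" by linarith
  moreover have "real k * \<rho> < of_int \<lceil>real k * \<rho>\<rceil>" using ne by linarith
  ultimately have "\<forall>\<^sub>F r in nhds \<rho>. of_int \<lceil>real k * \<rho>\<rceil> - 1 < real k * r \<and> real k * r < of_int \<lceil>real k * \<rho>\<rceil>"
    using order_tendstoD[OF t] by (intro eventually_conj)
  then show ?thesis by eventually_elim (simp add: ceiling_eq_iff)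
qed simp

lemma eq_crit_if_irrational:
  assumes a: "0 < a" "a < 1" and b: "0 \<le> b" "b < 1" and irr: "rotation_number a b \<notin> \<rat>"
  shows "\<exists>\<rho>\<in>{0..1}. b = crit a \<rho>"
proof -
  obtain \<rho> where \<rho>: "0 \<le> \<rho>" "\<rho> < 1" "rotation_number a b = \<rho>"
    and lo: "\<And>r. r < \<rho> \<Longrightarrow> crit a r \<le> b" and up: "\<And>r. \<rho> < r \<Longrightarrow> b \<le> crit a r"
    using rotation_number_cut[OF a b] by metis
  have irr: "\<rho> \<notin> \<rat>" using irr \<rho> by simp
  then have "\<rho> \<noteq> 0" by auto
  with \<rho> have "0 < \<rho>" by simp
  have "\<bar>b - crit a \<rho>\<bar> \<le> a ^ K" for K
  proof -
    have "\<forall>\<^sub>F r in nhds \<rho>. \<forall>k\<in>{..K}. \<lceil>real k * r\<rceil> = \<lceil>real k * \<rho>\<rceil>"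
      using eventually_ceiling_mult_eq[OF irr] by (intro eventually_ball_finite) auto
    moreover have "\<forall>\<^sub>F r in nhds \<rho>. r \<in> {0<..<1}"
      using \<open>0 < \<rho>\<close> \<rho> by (intro eventually_nhds_in_open) auto
    ultimately have "\<forall>\<^sub>F r in nhds \<rho>. (\<forall>k\<in>{..K}. \<lceil>real k * r\<rceil> = \<lceil>real k * \<rho>\<rceil>) \<and> r \<in> {0<..<1}"
      by (rule eventually_conj)
    then obtain \<epsilon> where "\<epsilon> > 0" and \<epsilon>:
      "\<And>r. dist r \<rho> < \<epsilon> \<Longrightarrow> (\<forall>k\<in>{..K}. \<lceil>real k * r\<rceil> = \<lceil>real k * \<rho>\<rceil>) \<and> r \<in> {0<..<1}"
      unfolding eventually_nhds_metric by blast
    \<comment> \<open>Both \<open>b\<close> and \<open>crit a \<rho>\<close> lie between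
      \<open>crit a r\<close> and \<open>crit a r'\<close>, which differ by at most
      \<open>a ^ K\<close> because their first ceilings agree.\<close>
    define r r' where "r = \<rho> - \<epsilon> / 2" and "r' = \<rho> + \<epsilon> / 2"
    have d: "dist r \<rho> < \<epsilon>" "dist r' \<rho> < \<epsilon>"
      using \<open>\<epsilon> > 0\<close> by (auto simp: r_def r'_def dist_real_def)
    have "\<bar>crit a r - crit a r'\<bar> \<le> a ^ K"
      using \<epsilon>[OF d(1)] \<epsilon>[OF d(2)] by (intro crit_diff_le_power[OF a]) auto
    moreover have "r < \<rho>" "\<rho> < r'" using \<open>\<epsilon> > 0\<close> by (auto simp: r_def r'_def)
    ultimately show ?thesis
      using lo[of r] up[of r'] crit_mono[OF a, of r \<rho>] crit_mono[OF a, of \<rho> r'] by linarith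
  qed
  moreover have "(\<lambda>K. a ^ K) \<longlonglongrightarrow> 0" using a by (simp add: LIMSEQ_power_zero)
  ultimately have "\<bar>b - crit a \<rho>\<bar> \<le> 0" by (intro LIMSEQ_le_const) auto
  then show ?thesis using \<rho> by auto
qed

section \<open>Range of \<open>crit\<close> and its dependence on \<open>a\<close>\<close>

lemma crit_bounds:
  assumes "0 < a" "a < 1" "0 \<le> \<rho>" "\<rho> < 1"
  shows "0 \<le> crit a \<rho>" "crit a \<rho> < 1"
proof -
  show "0 \<le> crit a \<rho>" using crit_mono[of a 0 \<rho>] assms by simp
  have "crit a \<rho> \<noteq> crit a 1" using crit_inj[of a \<rho> 1] assms by auto
  then show "crit a \<rho> < 1" using crit_mono[of a \<rho> 1] assms by simp
qed

text \<open>Coefficients in {0, 1} let the geometric series dominate both the series and its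
  increments in \<open>a\<close>. The constant stays bounded as long as \<open>a'\<close> stays away
  from 1.\<close>

lemma crit_lipschitz:
  assumes a: "0 < a" "a \<le> a'" "a' < 1" and r: "0 \<le> r" "r \<le> 1"
  shows "\<bar>crit a' r - crit a r\<bar> \<le> 2 * (a' - a) / (1 - a')"
proof -
  define d where "d = (\<lambda>k. of_int (\<lceil>real (Suc k) * r\<rceil> - \<lceil>real k * r\<rceil>) :: real)"
  define G where "G = (\<lambda>a. \<Sum>k. a ^ k * d k)"
  have d: "d k \<in> {0, 1}" for k unfolding d_def by (rule ceiling_diff_unit[OF r])
  have a': "0 < a'" "a < 1" using a by auto
  have s: "summable (\<lambda>k. x ^ k * d k)" if "0 < x" "x < 1" for x
    unfolding d_def by (rule summable_crit[OF that])
  have geo: "summable (\<lambda>k. x ^ k)" "(\<Sum>k. x ^ k) = 1 / (1 - x)" if "0 < x" "x < 1" for x :: real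
    using that by (auto intro!: summable_geometric suminf_geometric)
  have pw: "a ^ k \<le> a' ^ k" for k using a by (intro power_mono) auto
  have G0: "0 \<le> G a'" "G a' \<le> 1 / (1 - a')"
  proof -
    show "0 \<le> G a'" unfolding G_def
    proof (rule suminf_nonneg[OF s])
      show "0 \<le> a' ^ k * d k" for k using d[of k] a' by auto
    qed (use a' a in auto)
    show "G a' \<le> 1 / (1 - a')"
      unfolding G_def geo(2)[OF a'(1) a(3), symmetric]
    proof (rule suminf_le)
      show "a' ^ k * d k \<le> a' ^ k" for k using d[of k] a' by auto
    qed (use a' a in \<open>auto intro: s geo\<close>)
  qed
  have G1: "\<bar>G a' - G a\<bar> \<le> (a' - a) / ((1 - a') * (1 - a))"
  proof -
    have diff: "G a' - G a = (\<Sum>k. (a' ^ k - a ^ k) * d k)"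
      unfolding G_def using a a' by (subst suminf_diff) (auto intro: s simp: left_diff_distrib)
    also have "\<bar>\<dots>\<bar> \<le> (\<Sum>k. a' ^ k - a ^ k)"
      unfolding real_norm_def[symmetric]
    proof (rule norm_suminf_le)
      show "summable (\<lambda>k. a' ^ k - a ^ k)" using a a' by (intro summable_diff geo)
      show "norm ((a' ^ k - a ^ k) * d k) \<le> a' ^ k - a ^ k" for k
        using d[of k] pw[of k] by auto
    qed
    also have "\<dots> = 1 / (1 - a') - 1 / (1 - a)"
      using a a' by (simp add: suminf_diff[symmetric] geo)
    also have "\<dots> = (a' - a) / ((1 - a') * (1 - a))"
      using a a' by (simp add: field_simps)
    finally show ?thesis .
  qed
  \<comment> \<open>Product rule for \<open>(1 - a) * G a\<close>; each of the two summands is at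
    most \<open>(a' - a) / (1 - a')\<close> in absolute value.\<close>
  have "crit a' r - crit a r = (1 - a) * (G a' - G a) - (a' - a) * G a'"
    by (simp add: crit_def G_def d_def algebra_simps)
  also have "\<bar>\<dots>\<bar> \<le> (1 - a) * \<bar>G a' - G a\<bar> + (a' - a) * G a'"
    using a a' G0(1) by (intro order.trans[OF abs_triangle_ineq4]) (simp add: abs_mult)
  also have "\<dots> \<le> (1 - a) * ((a' - a) / ((1 - a') * (1 - a))) + (a' - a) * (1 / (1 - a'))"
    using a a' G0 G1 by (intro add_mono mult_left_mono) auto
  also have "(1 - a) * ((a' - a) / ((1 - a') * (1 - a))) = (a' - a) / (1 - a')"
    using a' by simp
  also have "(a' - a) / (1 - a') + (a' - a) * (1 / (1 - a')) = 2 * (a' - a) / (1 - a')"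
    by (simp add: add_divide_distrib[symmetric])
  finally show ?thesis .
qed

section \<open>Hausdorff null sets\<close>

text \<open>
  No bound on the diameters is needed in the covers: for \<open>s > 0\<close> a small total gauge forces
  small diameters.
\<close>

lemma hausdorff_measure_eq_0I:
  assumes "0 < s"
    and cov: "\<And>\<epsilon>::real. 0 < \<epsilon> \<Longrightarrow>
      \<exists>U. A \<subseteq> (\<Union>i. U i) \<and> (\<forall>i. bounded (U i)) \<and> (\<Sum>i. hausdorff_gauge s (U i)) \<le> ennreal \<epsilon>"
  shows "hausdorff_measure s A = 0"
proof -
  have "hausdorff_premeasure s \<delta> A \<le> ennreal \<epsilon>" if "0 < \<delta>" "0 < \<epsilon>" for \<delta> \<epsilon> :: real
  proof -
    define \<eta> where "\<eta> = min \<epsilon> (\<delta> powr s)"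
    have "0 < \<eta>" using that by (simp add: \<eta>_def)
    then obtain U where U: "A \<subseteq> (\<Union>i. U i)" "\<And>i. bounded (U i)"
      "(\<Sum>i. hausdorff_gauge s (U i)) \<le> ennreal \<eta>"
      using cov by blast
    have "diameter (U i) \<le> \<delta>" for i
    proof (cases "U i = {}")
      case False
      have "hausdorff_gauge s (U i) \<le> (\<Sum>i. hausdorff_gauge s (U i))"
        using sum_le_suminf[of "\<lambda>i. hausdorff_gauge s (U i)" "{i}"] by simp
      also note U(3)
      finally have "diameter (U i) powr s \<le> \<eta>"
        using False \<open>0 < s\<close> \<open>0 < \<eta>\<close> by (simp add: hausdorff_gauge_def)
      then have "diameter (U i) powr s \<le> \<delta> powr s" by (simp add: \<eta>_def)
      then show ?thesis
        using diameter_ge_0[OF U(2)] \<open>0 < s\<close> that by (meson less_imp_le not_le powr_less_mono2)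
    qed (use that in simp)
    then have "U \<in> delta_covers \<delta> A" using U by (auto simp: delta_covers_def)
    then have "hausdorff_premeasure s \<delta> A \<le> (\<Sum>i. hausdorff_gauge s (U i))"
      unfolding hausdorff_premeasure_def by (rule INF_lower)
    also have "\<dots> \<le> ennreal \<epsilon>"
      using U(3) by (rule order.trans) (simp add: \<eta>_def ennreal_leI)
    finally show ?thesis .
  qed
  then have "hausdorff_premeasure s \<delta> A \<le> 0 + ennreal \<epsilon>" if "0 < \<delta>" "0 < \<epsilon>" for \<delta> \<epsilon>
    using that by simp
  then have "hausdorff_premeasure s \<delta> A \<le> 0" if "0 < \<delta>" for \<delta>
    using ennreal_le_epsilon that by metis
  then have "hausdorff_measure s A \<le> 0"
    unfolding hausdorff_measure_def by (intro SUP_least) simp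
  then show ?thesis by simp
qed

text \<open>The \<open>m\<close>-th set gets the budget \<open>\<epsilon> / 2 ^ (m + 1)\<close>, and
  the double sequence of covering sets is flattened by the pairing function.\<close>

lemma countable_union_small_covers:
  fixes A :: "nat \<Rightarrow> 'a::metric_space set"
  assumes cov: "\<And>m \<epsilon>::real. 0 < \<epsilon> \<Longrightarrow>
      \<exists>U. A m \<subseteq> (\<Union>i. U i) \<and> (\<forall>i. bounded (U i)) \<and> (\<Sum>i. hausdorff_gauge s (U i)) \<le> ennreal \<epsilon>"
    and "0 < \<epsilon>"
  shows "\<exists>U. (\<Union>m. A m) \<subseteq> (\<Union>i::nat. U i) \<and> (\<forall>i. bounded (U i)) \<and>
    (\<Sum>i. hausdorff_gauge s (U i)) \<le> ennreal \<epsilon>"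
proof -
  have "\<exists>U. A m \<subseteq> (\<Union>i. U i) \<and> (\<forall>i. bounded (U i)) \<and>
      (\<Sum>i. hausdorff_gauge s (U i)) \<le> ennreal (\<epsilon> * (1/2) ^ Suc m)" for m
    using \<open>0 < \<epsilon>\<close> by (intro cov) simp
  then obtain V where V: "\<And>m. A m \<subseteq> (\<Union>i. V m i)" "\<And>m i. bounded (V m i)"
    "\<And>m. (\<Sum>i. hausdorff_gauge s (V m i)) \<le> ennreal (\<epsilon> * (1/2) ^ Suc m)"
    by metis
  define U where "U = (\<lambda>i. case_prod V (prod_decode i))"
  have "(\<Union>m. A m) \<subseteq> (\<Union>i. U i)"
  proof
    fix x assume "x \<in> (\<Union>m. A m)"
    then obtain m i where "x \<in> V m i" using V(1) by blast
    then have "x \<in> U (prod_encode (m, i))" by (simp add: U_def)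
    then show "x \<in> (\<Union>i. U i)" by blast
  qed
  moreover have "bounded (U i)" for i
    using V(2) by (simp add: U_def split: prod.split)
  moreover have "(\<Sum>i. hausdorff_gauge s (U i)) \<le> ennreal \<epsilon>"
  proof -
    have "(\<Sum>i. hausdorff_gauge s (U i)) = (\<Sum>m. \<Sum>i. hausdorff_gauge s (V m i))"
      unfolding U_def
      by (rule suminf_ennreal_2dimen[where f = "\<lambda>p. hausdorff_gauge s (case_prod V p)"]) simp
    also have "\<dots> \<le> (\<Sum>m. ennreal (\<epsilon> * (1/2) ^ Suc m))"
      using V(3) by (intro suminf_le) auto
    also have "\<dots> = ennreal \<epsilon>"
      using sums_mult[OF power_half_series, of \<epsilon>] \<open>0 < \<epsilon>\<close>
      by (intro sums_unique[symmetric]) (simp add: sums_ennreal)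
    finally show ?thesis .
  qed
  ultimately show ?thesis by blast
qed

lemma finite_small_cover:
  fixes V :: "'i \<Rightarrow> 'a::real_normed_vector set"
  assumes "finite I" "0 < s" "0 \<le> d" and A: "A \<subseteq> (\<Union>i\<in>I. V i)"
    and diam: "\<And>i x y. i \<in> I \<Longrightarrow> x \<in> V i \<Longrightarrow> y \<in> V i \<Longrightarrow> dist x y \<le> d"
  shows "\<exists>U. A \<subseteq> (\<Union>i::nat. U i) \<and> (\<forall>i. bounded (U i)) \<and>
    (\<Sum>i. hausdorff_gauge s (U i)) \<le> ennreal (real (card I) * d powr s)"
proof -
  obtain f where f: "bij_betw f {0..<card I} I"
    using ex_bij_betw_nat_finite[OF \<open>finite I\<close>] by blast
  \<comment> \<open>Padding with empty sets is free, as their gauge is 0.\<close>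
  define U where "U = (\<lambda>i. if i < card I then V (f i) else {})"
  have fI: "f i \<in> I" if "i < card I" for i using f that by (auto simp: bij_betw_def)
  have "A \<subseteq> (\<Union>i. U i)"
  proof
    fix x assume "x \<in> A"
    then obtain i where "i \<in> I" "x \<in> V i" using A by blast
    then have "i \<in> f ` {0..<card I}" using f by (simp add: bij_betw_def)
    then obtain k where "k < card I" "f k = i" by auto
    then have "x \<in> U k" using \<open>x \<in> V i\<close> by (simp add: U_def)
    then show "x \<in> (\<Union>i. U i)" by blast
  qed
  moreover have bd: "bounded (U i)" for i
  proof (cases "U i = {}")
    case False
    then obtain x where "x \<in> U i" by blast
    then have "U i \<subseteq> cball x d"
      using diam[OF fI] by (auto simp: U_def split: if_splits)
    then show ?thesis by (rule bounded_subset[OF bounded_cball])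
  qed simp
  moreover have "(\<Sum>i. hausdorff_gauge s (U i)) \<le> ennreal (real (card I) * d powr s)"
  proof -
    have "(\<Sum>i. hausdorff_gauge s (U i)) = (\<Sum>i\<in>{0..<card I}. hausdorff_gauge s (U i))"
      by (rule suminf_finite) (auto simp: U_def hausdorff_gauge_def)
    also have "\<dots> \<le> (\<Sum>i\<in>{0..<card I}. ennreal (d powr s))"
    proof (rule sum_mono)
      fix i assume i: "i \<in> {0..<card I}"
      have "diameter (U i) \<le> d"
        using i \<open>0 \<le> d\<close> diam[OF fI] by (intro diameter_le) (auto simp: U_def dist_norm)
      then have "diameter (U i) powr s \<le> d powr s"
        using diameter_ge_0[OF bd] \<open>0 < s\<close> by (intro powr_mono2) auto
      then show "hausdorff_gauge s (U i) \<le> ennreal (d powr s)"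
        using \<open>0 < s\<close> by (simp add: hausdorff_gauge_def ennreal_leI)
    qed
    also have "\<dots> = ennreal (real (card I) * d powr s)"
      by (simp add: ennreal_mult ennreal_of_nat_eq_real_of_nat)
    finally show ?thesis .
  qed
  ultimately show ?thesis by blast
qed

text \<open>The projection does not increase distances, so a cover of \<open>A\<close> yields
  intervals covering the unit interval whose lengths are the diameters. For \<open>s < 1\<close> and
  diameters at most 1 the gauge dominates the length, so the total gauge cannot drop below
  1.\<close>

lemma one_le_if_hausdorff_measure_eq_0:
  fixes A :: "(real \<times> real) set"
  assumes proj: "{0<..<1} \<subseteq> fst ` A" and "0 \<le> s" and null: "hausdorff_measure s A = 0"
  shows "1 \<le> s"
proof (rule ccontr)
  assume "\<not> 1 \<le> s"
  have "hausdorff_premeasure s 1 A \<le> hausdorff_measure s A"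
    unfolding hausdorff_measure_def by (rule SUP_upper) simp
  then have "hausdorff_premeasure s 1 A < 1" using null by simp
  then obtain U where U: "A \<subseteq> (\<Union>i. U i)" "\<And>i. bounded (U i)" "\<And>i. diameter (U i) \<le> 1"
    and small: "(\<Sum>i. hausdorff_gauge s (U i)) < 1"
    unfolding hausdorff_premeasure_def Inf_less_iff by (auto simp: delta_covers_def)
  \<comment> \<open>Projections of arbitrary covering sets may fail to be measurable; they are
    enlarged to closed intervals of the same length bound.\<close>
  define J where "J = (\<lambda>i. if U i = {} then {} else
    {Inf (fst ` U i) .. Inf (fst ` U i) + diameter (U i)})"
  have sub: "fst ` U i \<subseteq> J i" for i
  proof (cases "U i = {}")
    case False
    have le: "fst p \<le> fst q + diameter (U i)" if "p \<in> U i" "q \<in> U i" for p q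
      using dist_fst_le[of p q] diameter_bounded_bound[OF U(2) that] by (simp add: dist_real_def)
    have bdd: "bdd_below (fst ` U i)"
      by (rule bounded_imp_bdd_below[OF bounded_fst[OF U(2)]])
    have lower: "Inf (fst ` U i) \<le> fst p" if "p \<in> U i" for p
      by (rule cInf_lower[OF imageI[OF that] bdd])
    have upper: "fst p \<le> Inf (fst ` U i) + diameter (U i)" if "p \<in> U i" for p
    proof -
      have "fst p - diameter (U i) \<le> Inf (fst ` U i)"
        using False le[OF that] by (intro cInf_greatest) (auto simp: algebra_simps)
      then show ?thesis by simp
    qed
    show ?thesis using False lower upper by (force simp: J_def)
  qed (simp add: J_def)
  have gauge: "emeasure lborel (J i) \<le> hausdorff_gauge s (U i)" for i
  proof (cases "U i = {}")
    case False
    have d: "0 \<le> diameter (U i)" by (rule diameter_ge_0[OF U(2)])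
    then have "emeasure lborel (J i) = ennreal (diameter (U i))" using False by (simp add: J_def)
    also have "\<dots> \<le> hausdorff_gauge s (U i)"
    proof (cases "s = 0")
      case True
      then show ?thesis using False U(3)[of i] by (simp add: hausdorff_gauge_def)
    next
      assume "s \<noteq> 0"
      have "diameter (U i) powr 1 \<le> diameter (U i) powr s"
        using d U(3)[of i] \<open>\<not> 1 \<le> s\<close> by (intro powr_mono') auto
      then show ?thesis
        using False \<open>s \<noteq> 0\<close> d by (simp add: hausdorff_gauge_def ennreal_leI)
    qed
    finally show ?thesis .
  qed (simp add: J_def)
  have "J i \<in> sets lborel" for i by (simp add: J_def)
  then have J: "range J \<subseteq> sets lborel" by blast
  have "{0<..<1} \<subseteq> (\<Union>i. J i)"
  proof
    fix a :: real assume "a \<in> {0<..<1}"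
    then obtain p where "p \<in> A" "a = fst p" using proj by blast
    then obtain i where "p \<in> U i" using U(1) by blast
    then have "a \<in> J i" using sub[of i] \<open>a = fst p\<close> by blast
    then show "a \<in> (\<Union>i. J i)" by blast
  qed
  then have "emeasure lborel {0<..<1::real} \<le> emeasure lborel (\<Union>i. J i)"
    by (rule emeasure_mono) (rule sets.countable_UN[OF J])
  also have "\<dots> \<le> (\<Sum>i. emeasure lborel (J i))"
    by (rule emeasure_subadditive_countably[OF J])
  also have "\<dots> \<le> (\<Sum>i. hausdorff_gauge s (U i))"
    by (rule suminf_le[OF gauge]) simp_all
  also note small
  finally show False by simp
qed

section \<open>Covering the critical graphs\<close>

text \<open>The square is split evenly between two factors
  \<open>real n * sqrt x ^ n\<close>.\<close>

lemma power_times_square_limit_0: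
  fixes x :: real
  assumes "0 < x" "x < 1"
  shows "(\<lambda>n. (real n)\<^sup>2 * x ^ n) \<longlonglongrightarrow> 0"
proof -
  have "(\<lambda>n. (real n * sqrt x ^ n) * (real n * sqrt x ^ n)) \<longlonglongrightarrow> 0 * 0"
    using assms by (intro tendsto_mult powser_times_n_limit_0) auto
  moreover have "(real n * sqrt x ^ n) * (real n * sqrt x ^ n) = (real n)\<^sup>2 * x ^ n" for n
    using assms by (simp add: power2_eq_square power_mult_distrib[symmetric] mult_ac)
  ultimately show ?thesis by simp
qed

text \<open>
  The vectors \<open>(\<lceil>k * r\<rceil>)\<^sub>k\<close> increase with \<open>r\<close>, so the sum of the entries already determines
  the vector; this bounds the number of vectors.
\<close>

lemma ceiling_vector_eqI:
  fixes r r' :: real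
  assumes eq: "(\<Sum>k\<le>K. \<lceil>real k * r\<rceil>) = (\<Sum>k\<le>K. \<lceil>real k * r'\<rceil>)" and "k \<le> K"
  shows "\<lceil>real k * r\<rceil> = \<lceil>real k * r'\<rceil>"
proof -
  have le: "\<lceil>real k * r\<rceil> = \<lceil>real k * r'\<rceil>"
    if "r \<le> r'" "(\<Sum>k\<le>K. \<lceil>real k * r\<rceil>) = (\<Sum>k\<le>K. \<lceil>real k * r'\<rceil>)" for r r'
    by (rule sum_mono_inv[OF that(2)]) (use that(1) \<open>k \<le> K\<close> in \<open>auto intro!: ceiling_mono mult_left_mono\<close>)
  show ?thesis
  proof (cases "r \<le> r'")
    case True
    then show ?thesis by (rule le[OF _ eq])
  next
    case False
    then have "r' \<le> r" by simp
    then show ?thesis by (rule le[OF _ eq[symmetric], symmetric])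
  qed
qed

lemma ceiling_sum_range:
  fixes r :: real
  assumes "0 \<le> r" "r \<le> 1"
  shows "(\<Sum>k\<le>K. \<lceil>real k * r\<rceil>) \<in> {0..int (K * (K + 1))}"
proof -
  have "(\<Sum>k\<le>K. \<lceil>real k * r\<rceil>) \<le> (\<Sum>k\<le>K. int K)"
  proof (rule sum_mono)
    fix k assume "k \<in> {..K}"
    then have "real k * r \<le> real K * 1" using assms by (intro mult_mono) auto
    then show "\<lceil>real k * r\<rceil> \<le> int K" by (simp add: ceiling_le_iff)
  qed
  moreover have "0 \<le> (\<Sum>k\<le>K. \<lceil>real k * r\<rceil>)"
  proof (rule sum_nonneg)
    fix k
    have "0 \<le> real k * r" using assms by simp
    then show "0 \<le> \<lceil>real k * r\<rceil>" by linarith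
  qed
  ultimately show ?thesis by (simp add: algebra_simps)
qed

text \<open>With \<open>t = a0 ^ K\<close> there are at most
  \<open>(K\<^sup>2 + K + 1) * 2 / t\<close> cells of diameter at most \<open>L * t\<close>. Their
  total gauge is of order \<open>K\<^sup>2 * t powr (s - 1)\<close>, which vanishes as
  \<open>K\<close> grows because \<open>s > 1\<close>.\<close>

lemma crit_graphs_small_covers:
  fixes s a0 \<epsilon> :: real
  assumes a0: "0 < a0" "a0 < 1" and s: "1 < s" and "0 < \<epsilon>"
  shows "\<exists>U. {(a, crit a r) | a r. a \<in> {0<..a0} \<and> r \<in> {0..1}} \<subseteq> (\<Union>i::nat. U i) \<and>
    (\<forall>i. bounded (U i)) \<and> (\<Sum>i. hausdorff_gauge s (U i)) \<le> ennreal \<epsilon>"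
proof -
  \<comment> \<open>In units of \<open>t\<close>: one for the width of a strip, one for the
    truncated series, and \<open>2 / (1 - a0)\<close> from the Lipschitz estimate.\<close>
  define L where "L = 2 + 2 / (1 - a0)"
  have "0 < L" using a0 by (simp add: L_def add_pos_pos)
  \<comment> \<open>This sequence is the bound on the total gauge derived at the end, with
    \<open>t powr (s - 1)\<close> written as \<open>(a0 powr (s - 1)) ^ K\<close>.\<close>
  have "(\<lambda>K. 2 * L powr s * ((real K)\<^sup>2 * (a0 powr (s - 1)) ^ K + real K * (a0 powr (s - 1)) ^ K +
      (a0 powr (s - 1)) ^ K)) \<longlonglongrightarrow> 2 * L powr s * (0 + 0 + 0)"
  proof -
    have "a0 powr (s - 1) < 1" using powr_less_mono2[of "s - 1" a0 1] a0 s by simp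
    then show ?thesis using a0
      by (intro tendsto_mult tendsto_add tendsto_const power_times_square_limit_0
          powser_times_n_limit_0 LIMSEQ_power_zero) auto
  qed
  then have "\<forall>\<^sub>F K in sequentially. 2 * L powr s * ((real K)\<^sup>2 * (a0 powr (s - 1)) ^ K +
      real K * (a0 powr (s - 1)) ^ K + (a0 powr (s - 1)) ^ K) < \<epsilon>"
    using \<open>0 < \<epsilon>\<close> by (intro order_tendstoD) auto
  then obtain K where K: "2 * L powr s * ((real K)\<^sup>2 * (a0 powr (s - 1)) ^ K +
      real K * (a0 powr (s - 1)) ^ K + (a0 powr (s - 1)) ^ K) < \<epsilon>"
    unfolding eventually_sequentially by blast
  define t where "t = a0 ^ K"
  have t: "0 < t" "t \<le> 1" using a0 by (auto simp: t_def power_le_one)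
  define N where "N = nat \<lceil>1 / t\<rceil>"
  have N: "1 / t \<le> real N" "real N \<le> 2 / t"
  proof -
    show "1 / t \<le> real N" unfolding N_def by linarith
    have "1 \<le> 1 / t" using t by simp
    then have "real N \<le> 1 / t + 1 / t" unfolding N_def by linarith
    then show "real N \<le> 2 / t" by simp
  qed
  define S where "S = (\<lambda>r::real. \<Sum>k\<le>K. \<lceil>real k * r\<rceil>)"
  define I where "I = {0..int (K * (K + 1))} \<times> {0..<N}"
  \<comment> \<open>A cell is given by the sum of the ceilings, which encodes the whole vector, and
    by the strip of width \<open>t\<close> containing \<open>a\<close>.\<close>
  define V where "V = (\<lambda>(j, i). {(a, crit a r) | a r. a \<in> {0<..a0} \<and> r \<in> {0..1} \<and> S r = j \<and>
    nat \<lfloor>a / t\<rfloor> = i})"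
  have cover: "{(a, crit a r) | a r. a \<in> {0<..a0} \<and> r \<in> {0..1}} \<subseteq> (\<Union>p\<in>I. V p)"
  proof clarify
    fix a r :: real assume ar: "a \<in> {0<..a0}" "r \<in> {0..1}"
    have "a / t < 1 / t" using ar a0 t by (simp add: divide_strict_right_mono)
    then have "a / t < real N" using N by linarith
    moreover have "0 \<le> a / t" using ar t by simp
    ultimately have "nat \<lfloor>a / t\<rfloor> < N" by linarith
    then have "(S r, nat \<lfloor>a / t\<rfloor>) \<in> I"
      using ar ceiling_sum_range[of r K] by (auto simp: I_def S_def)
    moreover have "(a, crit a r) \<in> V (S r, nat \<lfloor>a / t\<rfloor>)"
      using ar by (auto simp: V_def)
    ultimately show "(a, crit a r) \<in> (\<Union>p\<in>I. V p)" by blast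
  qed
  \<comment> \<open>The intermediate point is \<open>(a, crit a r')\<close>: first \<open>r\<close>
    changes at fixed \<open>a\<close>, then \<open>a\<close> changes at fixed
    \<open>r'\<close>.\<close>
  have close: "dist (a, crit a r) (a', crit a' r') \<le> L * t"
    if "a \<le> a'" "a \<in> {0<..a0}" "a' \<in> {0<..a0}" "r \<in> {0..1}" "r' \<in> {0..1}" "S r = S r'"
      "nat \<lfloor>a / t\<rfloor> = nat \<lfloor>a' / t\<rfloor>" for a a' r r'
  proof -
    have "0 \<le> a / t" "0 \<le> a' / t" using that t by auto
    then have "a' / t - a / t \<le> 1" using that(7) by linarith
    then have aa: "a' - a \<le> t" using t by (simp add: field_simps)
    have "\<bar>crit a' r' - crit a r'\<bar> \<le> 2 * (a' - a) / (1 - a')"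
      using that a0 by (intro crit_lipschitz) auto
    also have "\<dots> \<le> 2 * t / (1 - a0)"
      using that a0 aa t by (intro frac_le) auto
    finally have 1: "\<bar>crit a' r' - crit a r'\<bar> \<le> 2 * t / (1 - a0)" .
    have "\<bar>crit a r - crit a r'\<bar> \<le> a ^ K"
      using that a0 ceiling_vector_eqI[of r K r'] by (intro crit_diff_le_power) (auto simp: S_def)
    also have "\<dots> \<le> t" unfolding t_def using that by (intro power_mono) auto
    finally have 2: "\<bar>crit a r - crit a r'\<bar> \<le> t" .
    have "dist (a, crit a r) (a', crit a' r') \<le> \<bar>a - a'\<bar> + \<bar>crit a r - crit a' r'\<bar>"
      using norm_Pair_le[of "a - a'" "crit a r - crit a' r'"] by (simp add: dist_norm)
    also have "\<dots> \<le> t + (t + 2 * t / (1 - a0))"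
      using 1 2 aa \<open>a \<le> a'\<close> by linarith
    also have "\<dots> = L * t" by (simp add: L_def algebra_simps)
    finally show ?thesis .
  qed
  have diam: "dist x y \<le> L * t" if xy: "x \<in> V p" "y \<in> V p" for p x y
  proof -
    obtain j i where p: "p = (j, i)" by (cases p)
    obtain a r where x: "x = (a, crit a r)" "a \<in> {0<..a0}" "r \<in> {0..1}" "S r = j" "nat \<lfloor>a / t\<rfloor> = i"
      using xy(1) by (auto simp: V_def p)
    obtain a' r' where y: "y = (a', crit a' r')" "a' \<in> {0<..a0}" "r' \<in> {0..1}" "S r' = j"
      "nat \<lfloor>a' / t\<rfloor> = i"
      using xy(2) by (auto simp: V_def p)
    show ?thesis
    proof (cases "a \<le> a'")
      case True
      then show ?thesis unfolding x(1) y(1) by (rule close) (use x y in simp_all)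
    next
      case False
      then have "a' \<le> a" by simp
      then have "dist y x \<le> L * t" unfolding x(1) y(1) by (rule close) (use x y in simp_all)
      then show ?thesis by (simp add: dist_commute)
    qed
  qed
  have "finite I" by (simp add: I_def)
  have "real (card I) * (L * t) powr s \<le> \<epsilon>"
  proof -
    have "real (card I) = ((real K)\<^sup>2 + real K + 1) * real N"
      by (simp add: I_def nat_add_distrib power2_eq_square algebra_simps flip: of_nat_mult of_nat_add)
    also have "\<dots> \<le> ((real K)\<^sup>2 + real K + 1) * (2 / t)"
      using N by (intro mult_left_mono) auto
    finally have "real (card I) * (L * t) powr s \<le> ((real K)\<^sup>2 + real K + 1) * (2 / t) * (L * t) powr s"
      by (intro mult_right_mono) auto
    also have "\<dots> = 2 * L powr s * (((real K)\<^sup>2 + real K + 1) * (t powr s / t))"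
      using \<open>0 < L\<close> t by (simp add: powr_mult)
    also have "t powr s / t = (a0 powr (s - 1)) ^ K"
    proof -
      have "t powr s / t = t powr (s - 1)" using t by (simp add: powr_diff)
      also have "\<dots> = (a0 powr (s - 1)) ^ K"
        using a0 by (simp add: t_def powr_realpow[symmetric] powr_powr mult.commute)
      finally show ?thesis .
    qed
    finally show ?thesis using K by (simp add: algebra_simps)
  qed
  then have le: "ennreal (real (card I) * (L * t) powr s) \<le> ennreal \<epsilon>" by (rule ennreal_leI)
  have "0 < s" "0 \<le> L * t" using s t \<open>0 < L\<close> by simp_all
  from finite_small_cover[OF \<open>finite I\<close> this cover]
  have "\<exists>U. {(a, crit a r) | a r. a \<in> {0<..a0} \<and> r \<in> {0..1}} \<subseteq> (\<Union>i::nat. U i) \<and>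
      (\<forall>i. bounded (U i)) \<and>
      (\<Sum>i. hausdorff_gauge s (U i)) \<le> ennreal (real (card I) * (L * t) powr s)"
    using diam by simp
  then show ?thesis
    by (elim ex_forward conj_forward) (use le in \<open>auto intro: order.trans\<close>)
qed

theorem theorem7p2:
  shows "hausdorff_dim {(a, b) \<in> {0<..<1::real} \<times> {0..<1::real}. rotation_number a b \<notin> \<rat>} = 1"
proof (rule antisym)
  let ?E = "{(a, b) \<in> {0<..<1::real} \<times> {0..<1::real}. rotation_number a b \<notin> \<rat>}"
  \<comment> \<open>The covering estimate degenerates as \<open>a\<close> approaches 1, so the
    parameter interval is exhausted from inside; \<open>real m + 2\<close> keeps the endpoint
    positive also for \<open>m = 0\<close>.\<close>
  define A where "A = (\<lambda>m. {(a, crit a r) | a r. a \<in> {0<..1 - 1 / (real m + 2)} \<and> r \<in> {0..1}})"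
  have E: "?E \<subseteq> (\<Union>m. A m)"
  proof clarify
    fix a b :: real
    assume ab: "a \<in> {0<..<1}" "b \<in> {0..<1}" "rotation_number a b \<notin> \<rat>"
    then obtain r where r: "r \<in> {0..1}" "b = crit a r"
      using eq_crit_if_irrational[of a b] by auto
    obtain m where "inverse (real (Suc m)) < 1 - a"
      using reals_Archimedean[of "1 - a"] ab by auto
    moreover have "1 / (real m + 2) \<le> inverse (real (Suc m))" by (simp add: field_simps)
    ultimately have "a \<le> 1 - 1 / (real m + 2)" by linarith
    then have "(a, b) \<in> A m" using ab r by (auto simp: A_def)
    then show "(a, b) \<in> (\<Union>m. A m)" by blast
  qed
  have null: "hausdorff_measure s ?E = 0" if "1 < s" for s
  proof (rule hausdorff_measure_eq_0I)
    fix \<epsilon> :: real assume "0 < \<epsilon>"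
    then have "\<exists>U. (\<Union>m. A m) \<subseteq> (\<Union>i::nat. U i) \<and> (\<forall>i. bounded (U i)) \<and>
        (\<Sum>i. hausdorff_gauge s (U i)) \<le> ennreal \<epsilon>"
      unfolding A_def using that
      by (intro countable_union_small_covers crit_graphs_small_covers) auto
    then show "\<exists>U. ?E \<subseteq> (\<Union>i. U i) \<and> (\<forall>i. bounded (U i)) \<and>
        (\<Sum>i. hausdorff_gauge s (U i)) \<le> ennreal \<epsilon>"
      by (elim ex_forward conj_forward) (use E in auto)
  qed (use that in simp)
  have le: "hausdorff_dim ?E \<le> ennreal s" if "1 < s" for s
    unfolding hausdorff_dim_def using null[OF that] that by (intro INF_lower) auto
  have "hausdorff_dim ?E \<le> 1 + ennreal e" if "0 < e" for e
  proof -
    have "hausdorff_dim ?E \<le> ennreal (1 + e)" by (rule le) (simp add: that)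
    also have "\<dots> = 1 + ennreal e" using that by simp
    finally show ?thesis .
  qed
  then show "hausdorff_dim ?E \<le> 1" by (rule ennreal_le_epsilon)
  have proj: "{0<..<1} \<subseteq> fst ` ?E"
  proof
    fix a :: real assume a: "a \<in> {0<..<1}"
    \<comment> \<open>A single irrational rotation number on every vertical line is enough for the
      projection.\<close>
    have "\<not> {0<..<1::real} \<subseteq> \<rat>"
      using uncountable_open_interval[of 0 "1::real"] countable_rat countable_subset by auto
    then obtain \<rho> :: real where "\<rho> \<in> {0<..<1}" and irr: "\<rho> \<notin> \<rat>" by blast
    then have \<rho>: "0 \<le> \<rho>" "\<rho> < 1" by simp_all
    then have "(a, crit a \<rho>) \<in> ?E"
      using a \<rho> irr crit_bounds[of a \<rho>] rotation_number_crit[of a \<rho>] by auto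
    then show "a \<in> fst ` ?E" by force
  qed
  show "1 \<le> hausdorff_dim ?E"
    unfolding hausdorff_dim_def
  proof (rule INF_greatest)
    fix s assume "s \<in> {s. 0 \<le> s \<and> hausdorff_measure s ?E = 0}"
    then have "1 \<le> s" using one_le_if_hausdorff_measure_eq_0[OF proj] by blast
    then show "1 \<le> ennreal s" by simp
  qed
qed

end
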